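(* Let $\mathcal H$ be a real Hilbert space, let $f:\mathcal H\to\mathbb R$ be a convex function of class $\mathcal C^1$ whose gradient is Lipschitz continuous and such that $\operatorname{argmin}_{\mathcal H} f\neq\emptyset$, and let $\alpha>0$, $s>0$. (i) Let $(x_k)$ be a sequence generated by the algorithm (NAG$_\alpha$), and let $(y_k)$ be the associated sequence given by $y_k = x_k+\left(1-\frac{\alpha}{k}\right)(x_k-x_{k-1})$. Then $(y_k)$ follows the algorithm (RAG$_\alpha$). (ii) Conversely, if $(y_k)$ is a sequence generated by (RAG$_\alpha$), then the sequence $(x_k)$ defined by $x_{k+1}=y_k-s\nabla f(y_k)$ obeys the algorithm (NAG$_\alpha$).
   Context: The Nesterov accelerated gradient algorithm (NAG$_\alpha$) with step size $s$ is the recursion $$y_k = x_k+\left(1-\tfrac{\alpha}{k}\right)(x_k-x_{k-1}),\qquad x_{k+1}=y_k-s\nabla f(y_k).$$ The Ravine accelerated gradient algorithm (RAG$_\alpha$) with step size $s$ is the recursion $$w_k=y_k-s\nabla f(y_k),\qquad y_{k+1}=w_k+\left(1-\tfrac{\alpha}{k+1}\right)(w_k-w_{k-1}).$$ Each algorithm is started from two arbitrary initial points. A sequence "follows" (or "obeys") an algorithm if the corresponding recursion holds for all integers $k\ge 1$ for which all terms appearing in it are defined. *)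

theory Defs
  imports "HOL-Analysis.Analysis"
begin

text \<open>
  A sequence indexed by a subset \<open>D\<close> of the natural numbers is represented by a total function
  on \<open>nat\<close> together with \<open>D\<close>; its values outside \<open>D\<close> are irrelevant.
  An algorithm is started from its points of index \<open>0\<close> and \<open>1\<close>, so a sequence generated by it
  is one that follows it with \<open>D = UNIV\<close>.  The parameter \<open>g\<close> is the gradient of the objective.
\<close>

definition nag_y :: "real \<Rightarrow> (nat \<Rightarrow> 'a::real_vector) \<Rightarrow> nat \<Rightarrow> 'a" where
  "nag_y \<alpha> x k = x k + (1 - \<alpha> / real k) *\<^sub>R (x k - x (k - 1))"

definition rag_w :: "('a \<Rightarrow> 'a) \<Rightarrow> real \<Rightarrow> (nat \<Rightarrow> 'a::real_vector) \<Rightarrow> nat \<Rightarrow> 'a" where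
  "rag_w g s y k = y k - s *\<^sub>R g (y k)"

text \<open>
  The recursions are required at those \<open>k \<ge> 1\<close> for which all their terms are defined:
  \<open>y\<^sub>k\<close> in NAG involves \<open>x\<^sub>k\<close> and \<open>x\<^bsub>k-1\<^esub>\<close>, and \<open>w\<^bsub>k-1\<^esub>\<close> in RAG involves \<open>y\<^bsub>k-1\<^esub>\<close>;
  in particular \<open>w\<^sub>0\<close> is the gradient step from \<open>y\<^sub>0\<close>, not a free initial point.
\<close>

definition follows_NAG ::
    "('a \<Rightarrow> 'a) \<Rightarrow> real \<Rightarrow> real \<Rightarrow> nat set \<Rightarrow> (nat \<Rightarrow> 'a::real_vector) \<Rightarrow> bool" where
  "follows_NAG g \<alpha> s D x \<longleftrightarrow>
     (\<forall>k\<ge>1. {k - 1, k, k + 1} \<subseteq> D \<longrightarrow>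
        x (k + 1) = nag_y \<alpha> x k - s *\<^sub>R g (nag_y \<alpha> x k))"

definition follows_RAG ::
    "('a \<Rightarrow> 'a) \<Rightarrow> real \<Rightarrow> real \<Rightarrow> nat set \<Rightarrow> (nat \<Rightarrow> 'a::real_vector) \<Rightarrow> bool" where
  "follows_RAG g \<alpha> s D y \<longleftrightarrow>
     (\<forall>k\<ge>1. {k - 1, k, k + 1} \<subseteq> D \<longrightarrow>
        y (k + 1) = rag_w g s y k
          + (1 - \<alpha> / real (k + 1)) *\<^sub>R (rag_w g s y k - rag_w g s y (k - 1)))"

end

theory Submission imports Defs
begin

text \<open>
  The two algorithms are the same alternation of two elementary moves: an extrapolation
  \<open>y\<^sub>k = x\<^sub>k + (1 - \<alpha>/k) (x\<^sub>k - x\<^bsub>k-1\<^esub>)\<close> and a gradient step \<open>x\<^bsub>k+1\<^esub> = y\<^sub>k - s \<nabla>f(y\<^sub>k)\<close>.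
  NAG records the points \<open>x\<^sub>k\<close> and eliminates the \<open>y\<^sub>k\<close>; RAG records the \<open>y\<^sub>k\<close> and
  eliminates the \<open>x\<^sub>k\<close>, which reappear as the gradient steps \<open>w\<^sub>k = x\<^bsub>k+1\<^esub>\<close>.  Once this shift of
  index is in place, the right-hand side of the RAG recursion at \<open>k\<close> is the Nesterov extrapolation
  of \<open>x\<close> at \<open>k + 1\<close> (lemma \<open>nag_y_of_gradient_steps\<close>), and each recursion turns into the other.

  The translation costs one index at the start.  If \<open>x\<close> starts at \<open>0\<close>, the first extrapolated
  point is \<open>y\<^sub>1\<close>; if \<open>y\<close> starts at \<open>0\<close>, the first gradient step is \<open>x\<^sub>1\<close>.  Hence the sequence
  obtained in either direction lives on the index set \<open>{1..}\<close>, where its recursion is required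
  from \<open>k = 2\<close> on.
\<close>

lemma nag_y_of_gradient_steps:
  assumes "x k = rag_w g s y (k - 1)"
    and "x (k + 1) = rag_w g s y k"
  shows "nag_y \<alpha> x (k + 1) = rag_w g s y k
           + (1 - \<alpha> / real (k + 1)) *\<^sub>R (rag_w g s y k - rag_w g s y (k - 1))"
  using assms by (simp add: nag_y_def)

text \<open>
  The NAG recursion says that \<open>x\<^bsub>k+1\<^esub>\<close> is the gradient step from \<open>y\<^sub>k\<close>, so that the definition of
  \<open>y\<^bsub>k+1\<^esub>\<close> by extrapolation is already the RAG recursion.
\<close>

lemma follows_RAG_if_follows_NAG:
  assumes NAG: "follows_NAG g \<alpha> s UNIV x"
    and y: "\<And>k. k \<ge> 1 \<Longrightarrow> y k = nag_y \<alpha> x k"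
  shows "follows_RAG g \<alpha> s {1..} y"
  unfolding follows_RAG_def
proof (intro allI impI)
  fix k :: nat
  assume "1 \<le> k" and "{k - 1, k, k + 1} \<subseteq> {1..}"
  then have k: "2 \<le> k" by auto
  have step: "x (j + 1) = rag_w g s y j" if "1 \<le> j" for j
    using NAG y that by (simp add: follows_NAG_def rag_w_def)
  have "x k = rag_w g s y (k - 1)"
    using step[of "k - 1"] k by simp
  moreover have "x (k + 1) = rag_w g s y k"
    using step k by simp
  ultimately have "nag_y \<alpha> x (k + 1) = rag_w g s y k
      + (1 - \<alpha> / real (k + 1)) *\<^sub>R (rag_w g s y k - rag_w g s y (k - 1))"
    by (rule nag_y_of_gradient_steps)
  then show "y (k + 1) = rag_w g s y k
      + (1 - \<alpha> / real (k + 1)) *\<^sub>R (rag_w g s y k - rag_w g s y (k - 1))"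
    using y by simp
qed

text \<open>
  The RAG recursion at \<open>k - 1\<close> says that \<open>y\<^sub>k\<close> is the Nesterov extrapolation of the gradient
  steps \<open>x\<^sub>k\<close> and \<open>x\<^bsub>k-1\<^esub>\<close>, so that the definition of \<open>x\<^bsub>k+1\<^esub>\<close> as the gradient step from \<open>y\<^sub>k\<close> is
  already the NAG recursion.
\<close>

lemma follows_NAG_if_follows_RAG:
  assumes RAG: "follows_RAG g \<alpha> s UNIV y"
    and x: "\<And>k. x (k + 1) = rag_w g s y k"
  shows "follows_NAG g \<alpha> s {1..} x"
  unfolding follows_NAG_def
proof (intro allI impI)
  fix k :: nat
  assume "1 \<le> k" and "{k - 1, k, k + 1} \<subseteq> {1..}"
  then obtain j where j: "k = j + 1" "1 \<le> j"
    by (cases k) auto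
  have "x j = rag_w g s y (j - 1)"
    using x[of "j - 1"] j by simp
  then have "nag_y \<alpha> x (j + 1) = rag_w g s y j
      + (1 - \<alpha> / real (j + 1)) *\<^sub>R (rag_w g s y j - rag_w g s y (j - 1))"
    using x by (intro nag_y_of_gradient_steps)
  also have "\<dots> = y (j + 1)"
    using RAG j by (simp add: follows_RAG_def)
  finally have "nag_y \<alpha> x k = y k"
    using j by simp
  then show "x (k + 1) = nag_y \<alpha> x k - s *\<^sub>R g (nag_y \<alpha> x k)"
    using x by (simp add: rag_w_def)
qed

theorem theorem2p2:
  fixes f :: "'a::{real_inner, complete_space} \<Rightarrow> real"
    and gradf :: "'a \<Rightarrow> 'a"
    and \<alpha> s :: real
  assumes "convex_on UNIV f"
    and "\<And>z. GDERIV f z :> gradf z"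
    and "continuous_on UNIV gradf"
    and "\<exists>L. L-lipschitz_on UNIV gradf"
    and "{z. is_arg_min f (\<lambda>_. True) z} \<noteq> {}"
    and "\<alpha> > 0"
    and "s > 0"
  shows "(\<forall>x y. follows_NAG gradf \<alpha> s UNIV x \<and>
              (\<forall>k\<ge>1. y k = x k + (1 - \<alpha> / real k) *\<^sub>R (x k - x (k - 1)))
            \<longrightarrow> follows_RAG gradf \<alpha> s {1..} y) \<and>
         (\<forall>x y. follows_RAG gradf \<alpha> s UNIV y \<and>
              (\<forall>k. x (k + 1) = y k - s *\<^sub>R gradf (y k))
            \<longrightarrow> follows_NAG gradf \<alpha> s {1..} x)"
proof (intro conjI allI impI; elim conjE)
  fix x y :: "nat \<Rightarrow> 'a"
  assume "follows_NAG gradf \<alpha> s UNIV x"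
    and "\<forall>k\<ge>1. y k = x k + (1 - \<alpha> / real k) *\<^sub>R (x k - x (k - 1))"
  then show "follows_RAG gradf \<alpha> s {1..} y"
    by (intro follows_RAG_if_follows_NAG) (auto simp: nag_y_def)
next
  fix x y :: "nat \<Rightarrow> 'a"
  assume "follows_RAG gradf \<alpha> s UNIV y"
    and "\<forall>k. x (k + 1) = y k - s *\<^sub>R gradf (y k)"
  then show "follows_NAG gradf \<alpha> s {1..} x"
    by (intro follows_NAG_if_follows_RAG) (auto simp: rag_w_def)
qed

end
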